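(* Let $p=(12,R)$ be the mesh pattern with $R=\{(0,1),(0,2),(1,0),(1,1),(1,2),(2,1)\}$. Let $T_{n,k}$ be the number of permutations in $S_n$ with exactly $k$ occurrences of $p$, and let $T_n(x)=\sum_{k=0}^{n-1}T_{n,k}x^k$. Then for all $n\ge 3$ and $k\ge0$, $$\begin{aligned}T_{n,k} ={}& (k + 1) T_{n - 1, k + 1} + (n - k - 1) T_{n - 1, k} + T_{n - 1, k - 1} \\ &+ (k + 1) T_{n - 2, k + 1} + (n - 2 k - 2) T_{n - 2, k} - (n - k - 1) T_{n - 2, k - 1},\end{aligned}$$ with the initial conditions $T_{1,0}=1$, $T_{2,0}=1$, $T_{2,1}=1$. Equivalently, for all $n\ge3$, $$T_n(x) = (x+n-1) T_{n-1}(x) + (1-x) T'_{n-1}(x) +(n-2) (1-x) T_{n-2}(x) + (1-x)^2 T'_{n-2}(x),$$ with the initial conditions $T_1(x)=1$ and $T_2(x)=1+x$.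
   Context: $S_n$ is the set of permutations $\pi=\pi_1\cdots\pi_n$ of $\{1,\dots,n\}$. A mesh pattern $(12,R)$ consists of the permutation $12$ and a set $R\subseteq\{0,1,2\}\times\{0,1,2\}$ of shaded boxes. An occurrence of $(12,R)$ in $\pi\in S_n$ is a pair of positions $s<t$ with $\pi_s<\pi_t$ such that, putting $s_0=0,\ s_1=s,\ s_2=t,\ s_3=n+1$ and $v_0=0,\ v_1=\pi_s,\ v_2=\pi_t,\ v_3=n+1$, for every $(i,j)\in R$ there is no position $m$ with $s_i<m<s_{i+1}$ and $v_j<\pi_m<v_{j+1}$. By convention $T_{n,-1}=0$. $T'_n(x)$ is the derivative of $T_n(x)$ with respect to $x$. *)

theory Defs
  imports "HOL-Combinatorics.Permutations" "HOL-Computational_Algebra.Polynomial"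
begin

text \<open>
  A permutation in \<open>S\<^sub>n\<close> is a function \<open>\<pi>\<close> with \<open>\<pi> permutes {1..n}\<close>; its one-line
  notation is \<open>\<pi> 1, \<dots>, \<pi> n\<close>.
\<close>

text \<open>The lines of the mesh in one direction, \<open>grid n a b i\<close> for \<open>i \<le> 3\<close>.\<close>

definition grid :: "nat \<Rightarrow> nat \<Rightarrow> nat \<Rightarrow> nat \<Rightarrow> nat" where
  "grid n a b i = [0, a, b, n + 1] ! i"

text \<open>
  The occurrences of the mesh pattern \<open>(12, R)\<close>, \<open>R \<subseteq> {0,1,2} \<times> {0,1,2}\<close>, in \<open>\<pi> \<in> S\<^sub>n\<close>.
  In a box \<open>(i, j)\<close> the first coordinate is horizontal (positions), the second vertical (values).
\<close>

definition mesh12_occs :: "(nat \<times> nat) set \<Rightarrow> nat \<Rightarrow> (nat \<Rightarrow> nat) \<Rightarrow> (nat \<times> nat) set" where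
  "mesh12_occs R n \<pi> =
     {(s, t). s \<in> {1..n} \<and> t \<in> {1..n} \<and> s < t \<and> \<pi> s < \<pi> t \<and>
        (\<forall>(i, j) \<in> R. \<not> (\<exists>m \<in> {1..n}.
            grid n s t i < m \<and> m < grid n s t (i + 1) \<and>
            grid n (\<pi> s) (\<pi> t) j < \<pi> m \<and> \<pi> m < grid n (\<pi> s) (\<pi> t) (j + 1)))}"

definition shaded :: "(nat \<times> nat) set" where
  "shaded = {(0,1), (0,2), (1,0), (1,1), (1,2), (2,1)}"

text \<open>
  The numbers \<open>T\<^sub>n\<^sub>,\<^sub>k\<close>. The index \<open>k\<close> is an integer, so that the convention
  \<open>T\<^sub>n\<^sub>,\<^sub>-\<^sub>1 = 0\<close> holds because no permutation has a negative number of occurrences.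
  The value is an integer because the recurrence has coefficients that may be negative.
\<close>

definition T :: "nat \<Rightarrow> int \<Rightarrow> int" where
  "T n k = int (card {\<pi>. \<pi> permutes {1..n} \<and> int (card (mesh12_occs shaded n \<pi>)) = k})"

definition T_poly :: "nat \<Rightarrow> int poly" where
  "T_poly n = (\<Sum>k<n. monom (T n (int k)) k)"

end

theory Submission
  imports Defs
begin

text \<open>
  An occurrence of the pattern is a position \<open>s\<close> such that \<open>\<pi> s\<close> is a left-to-right maximum
  and \<open>\<pi> (s + 1) = \<pi> s + 1\<close>: shading the middle column makes the two positions adjacent,
  shading the middle row makes the two values adjacent, and shading \<open>(0,2)\<close> makes the lower
  value a left-to-right maximum. Every permutation of \<open>n + 1\<close> letters arises exactly once by
  appending a last value \<open>v\<close> to some \<open>\<sigma> \<in> S\<^sub>n\<close>, with the values from \<open>v\<close> on moved up by one.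
  Left-to-right maxima are preserved by this operation; an occurrence of \<open>\<sigma>\<close> is destroyed
  iff \<open>v\<close> is wedged between its two values; and a new occurrence is created only if \<open>\<sigma>\<close> ends
  with its maximum \<open>n\<close> and \<open>v = n + 1\<close>.

  Let \<open>W\<^sub>n\<close> (\<open>succ_poly n\<close>) be the generating polynomial of the number of occurrences over
  \<open>S\<^sub>n\<close>, and \<open>E\<^sub>n\<close> (\<open>succ_poly_max_last n\<close>) that over the permutations with \<open>\<pi> n = n\<close>. If \<open>\<sigma>\<close> has \<open>k\<close> occurrences, then among the values
  \<open>v \<le> n\<close> exactly \<open>k\<close> destroy one occurrence and the others change nothing, while \<open>v = n + 1\<close>
  contributes to \<open>E\<^sub>n\<^sub>+\<^sub>1\<close>. For \<open>n \<ge> 1\<close> this gives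
  \<open>W\<^sub>n\<^sub>+\<^sub>1 = n W\<^sub>n + (1 - x) W\<^sub>n' + E\<^sub>n\<^sub>+\<^sub>1\<close> and \<open>E\<^sub>n\<^sub>+\<^sub>1 = W\<^sub>n + (x - 1) E\<^sub>n\<close>.
  Solving the first equation (at the preceding index) for \<open>E\<^sub>n\<close> and substituting it into
  the second yields the recurrence for the polynomials; comparing coefficients yields the one
  for the numbers.
\<close>

section \<open>Occurrences as successions at left-to-right maxima\<close>

definition lrmax_successions :: "nat \<Rightarrow> (nat \<Rightarrow> nat) \<Rightarrow> nat set" where
  "lrmax_successions n \<pi> =
     {s \<in> {1..<n}. \<pi> (Suc s) = Suc (\<pi> s) \<and> (\<forall>m \<in> {1..<s}. \<pi> m < \<pi> s)}"

lemma finite_lrmax_successions [simp]: "finite (lrmax_successions n \<pi>)"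
  by (simp add: lrmax_successions_def)

lemma card_lrmax_successions_less:
  assumes "n \<ge> 1"
  shows "card (lrmax_successions n \<pi>) < n"
proof -
  have "card (lrmax_successions n \<pi>) \<le> card {1..<n}"
    by (rule card_mono) (auto simp: lrmax_successions_def)
  with assms show ?thesis by simp
qed

lemma mesh12_occs_shaded:
  assumes p: "\<pi> permutes {1..n}"
  shows "mesh12_occs shaded n \<pi> = (\<lambda>s. (s, Suc s)) ` lrmax_successions n \<pi>"
proof -
  have inj: "\<pi> i = \<pi> j \<longleftrightarrow> i = j" for i j
    using permutes_inj[OF p] by (auto dest: injD)
  have rng: "1 \<le> \<pi> i \<and> \<pi> i \<le> n" if "1 \<le> i" "i \<le> n" for i
    using permutes_in_image[OF p, of i] that by auto
  have mem: "(s, t) \<in> mesh12_occs shaded n \<pi> \<longleftrightarrow> t = Suc s \<and> s \<in> lrmax_successions n \<pi>" for s t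
  proof
    assume "(s, t) \<in> mesh12_occs shaded n \<pi>"
    then have st: "1 \<le> s" "t \<le> n" "s < t" "\<pi> s < \<pi> t"
      and b01: "\<And>m. \<lbrakk>1 \<le> m; m \<le> n; m < s; \<pi> s < \<pi> m; \<pi> m < \<pi> t\<rbrakk> \<Longrightarrow> False"
      and b02: "\<And>m. \<lbrakk>1 \<le> m; m \<le> n; m < s; \<pi> t < \<pi> m; \<pi> m < Suc n\<rbrakk> \<Longrightarrow> False"
      and b10: "\<And>m. \<lbrakk>1 \<le> m; m \<le> n; s < m; m < t; 0 < \<pi> m; \<pi> m < \<pi> s\<rbrakk> \<Longrightarrow> False"
      and b11: "\<And>m. \<lbrakk>1 \<le> m; m \<le> n; s < m; m < t; \<pi> s < \<pi> m; \<pi> m < \<pi> t\<rbrakk> \<Longrightarrow> False"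
      and b12: "\<And>m. \<lbrakk>1 \<le> m; m \<le> n; s < m; m < t; \<pi> t < \<pi> m; \<pi> m < Suc n\<rbrakk> \<Longrightarrow> False"
      and b21: "\<And>m. \<lbrakk>1 \<le> m; m \<le> n; t < m; m < Suc n; \<pi> s < \<pi> m; \<pi> m < \<pi> t\<rbrakk> \<Longrightarrow> False"
      unfolding mesh12_occs_def shaded_def grid_def
      by (auto simp: numeral_2_eq_2 numeral_3_eq_3)
    \<comment> \<open>An entry at position \<open>s + 1 < t\<close> would lie in one of the boxes of the middle column.\<close>
    have t: "t = Suc s"
    proof (rule ccontr)
      assume "t \<noteq> Suc s"
      with st have m: "1 \<le> Suc s" "Suc s \<le> n" "Suc s < t" by auto
      from rng[OF m(1,2)] b10[of "Suc s"] b11[of "Suc s"] b12[of "Suc s"] m st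
        inj[of "Suc s" s] inj[of "Suc s" t]
      show False by linarith
    qed
    \<comment> \<open>An entry of value \<open>\<pi> s + 1 < \<pi> t\<close> would lie in one of the boxes of the middle row.\<close>
    have succ: "\<pi> t = Suc (\<pi> s)"
    proof (rule ccontr)
      assume ne: "\<pi> t \<noteq> Suc (\<pi> s)"
      have "Suc (\<pi> s) \<in> \<pi> ` {1..n}"
        unfolding permutes_image[OF p] using ne st rng[of t] by auto
      then obtain m where m: "1 \<le> m" "m \<le> n" "\<pi> m = Suc (\<pi> s)" by auto
      then have "m \<noteq> s" "m \<noteq> t" using ne by auto
      with b01[of m] b11[of m] b21[of m] m ne st show False by linarith
    qed
    have "\<pi> m < \<pi> s" if "m \<in> {1..<s}" for m
      using b01[of m] b02[of m] that st rng[of m] inj[of m s] inj[of m t] by fastforce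
    with t succ st show "t = Suc s \<and> s \<in> lrmax_successions n \<pi>"
      by (auto simp: lrmax_successions_def)
  next
    assume "t = Suc s \<and> s \<in> lrmax_successions n \<pi>"
    then have t: "t = Suc s" and s: "1 \<le> s" "s < n" and succ: "\<pi> (Suc s) = Suc (\<pi> s)"
      and less: "\<And>m. \<lbrakk>1 \<le> m; m < s\<rbrakk> \<Longrightarrow> \<pi> m < \<pi> s"
      by (auto simp: lrmax_successions_def)
    have "\<not> Suc (\<pi> s) < \<pi> m" if "1 \<le> m" "m < s" for m
      using less[OF that] by simp
    then show "(s, t) \<in> mesh12_occs shaded n \<pi>"
      unfolding mesh12_occs_def shaded_def grid_def t
      using s by (auto simp: succ numeral_2_eq_2 numeral_3_eq_3)
  qed
  show ?thesis using mem by auto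
qed

lemma card_mesh12_occs_shaded:
  "\<pi> permutes {1..n} \<Longrightarrow> card (mesh12_occs shaded n \<pi>) = card (lrmax_successions n \<pi>)"
  by (simp add: mesh12_occs_shaded card_image inj_on_def)

section \<open>Appending a last value\<close>

text \<open>Since \<open>\<sigma> 0 = 0\<close>, position \<open>0\<close> stays fixed as long as \<open>v \<ge> 1\<close>.\<close>

definition append_value :: "nat \<Rightarrow> (nat \<Rightarrow> nat) \<Rightarrow> nat \<Rightarrow> nat \<Rightarrow> nat" where
  "append_value n \<sigma> v = (\<lambda>i. if i \<le> n then (if \<sigma> i < v then \<sigma> i else Suc (\<sigma> i))
                              else if i = Suc n then v else i)"

lemma append_value_permutes:
  assumes p: "\<sigma> permutes {1..n}" and v: "v \<in> {1..Suc n}"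
  shows "append_value n \<sigma> v permutes {1..Suc n}"
proof (rule bij_imp_permutes)
  have inj: "\<sigma> i = \<sigma> j \<longleftrightarrow> i = j" for i j
    using permutes_inj[OF p] by (auto dest: injD)
  have rng: "1 \<le> \<sigma> i \<and> \<sigma> i \<le> n" if "1 \<le> i" "i \<le> n" for i
    using permutes_in_image[OF p, of i] that by auto
  have "inj_on (append_value n \<sigma> v) {1..Suc n}"
  proof (rule inj_onI)
    fix i j
    assume "i \<in> {1..Suc n}" "j \<in> {1..Suc n}" "append_value n \<sigma> v i = append_value n \<sigma> v j"
    then show "i = j"
      using inj[of i j] by (auto simp: append_value_def le_Suc_eq split: if_splits)
  qed
  moreover have "append_value n \<sigma> v ` {1..Suc n} \<subseteq> {1..Suc n}"
    using rng v by (auto simp: append_value_def intro: le_SucI)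
  ultimately show "bij_betw (append_value n \<sigma> v) {1..Suc n} {1..Suc n}"
    by (simp add: bij_betw_def endo_inj_surj)
next
  fix i assume "i \<notin> {1..Suc n}"
  then show "append_value n \<sigma> v i = i"
    using permutes_not_in[OF p, of 0] v by (auto simp: append_value_def not_le)
qed

text \<open>
  The appended value and the original permutation can be read off, so appending is injective;
  both sides have \<open>(n + 1)!\<close> elements, so it is onto.
\<close>

lemma bij_betw_append_value:
  "bij_betw (\<lambda>(\<sigma>, v). append_value n \<sigma> v)
     ({\<sigma>. \<sigma> permutes {1..n}} \<times> {1..Suc n}) {\<pi>. \<pi> permutes {1..Suc n}}"
proof -
  let ?A = "{\<sigma>. \<sigma> permutes {1..n}} \<times> {1..Suc n}"
  let ?B = "{\<pi>. \<pi> permutes {1..Suc n}}"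
  let ?f = "\<lambda>(\<sigma>, v). append_value n \<sigma> v"
  have inj: "inj_on ?f ?A"
  proof (rule inj_onI, clarify)
    fix \<sigma> v \<tau> w
    assume s: "\<sigma> permutes {1..n}" and t: "\<tau> permutes {1..n}"
      and eq: "append_value n \<sigma> v = append_value n \<tau> w"
    have vw: "v = w" using fun_cong[OF eq, of "Suc n"] by (simp add: append_value_def)
    have "\<sigma> i = \<tau> i" for i
    proof (cases "i \<le> n")
      case True
      then show ?thesis using fun_cong[OF eq, of i] vw
        by (auto simp: append_value_def split: if_splits)
    next
      case False
      then show ?thesis using permutes_not_in[OF s, of i] permutes_not_in[OF t, of i] by simp
    qed
    with vw show "\<sigma> = \<tau> \<and> v = w" by auto
  qed
  have sub: "?f ` ?A \<subseteq> ?B" using append_value_permutes by auto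
  have "card ?A = card ?B"
    by (simp add: card_cartesian_product card_permutations[OF refl] algebra_simps)
  then have "?f ` ?A = ?B"
    using sub card_image[OF inj] by (intro card_subset_eq) (auto simp: finite_permutations)
  with inj show ?thesis by (simp add: bij_betw_def)
qed

lemma sum_permutes_Suc:
  fixes f :: "(nat \<Rightarrow> nat) \<Rightarrow> 'a :: comm_monoid_add"
  shows "(\<Sum>\<pi> | \<pi> permutes {1..Suc n}. f \<pi>)
       = (\<Sum>\<sigma> | \<sigma> permutes {1..n}. \<Sum>v\<in>{1..Suc n}. f (append_value n \<sigma> v))"
  using sum.reindex_bij_betw[OF bij_betw_append_value, of f n]
  by (simp add: sum.cartesian_product case_prod_unfold del: sum.cl_ivl_Suc)

text \<open>
  The values of \<open>\<sigma>\<close> are relabelled in an order-preserving way, so old positions keep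
  their status as left-to-right maxima, and a succession \<open>a, a + 1\<close> survives unless \<open>v = a + 1\<close>.
  If position \<open>n\<close> is an occurrence, then its value is the largest of the first \<open>n\<close>, which
  forces \<open>\<sigma> n = n\<close>.
\<close>

lemma lrmax_successions_append_value:
  assumes p: "\<sigma> permutes {1..n}" and v: "v \<in> {1..Suc n}" and n: "n \<ge> 1"
  shows "lrmax_successions (Suc n) (append_value n \<sigma> v)
       = {s \<in> lrmax_successions n \<sigma>. Suc (\<sigma> s) \<noteq> v} \<union> (if v = Suc n \<and> \<sigma> n = n then {n} else {})"
    (is "?L = ?R")
proof (rule set_eqI)
  fix s
  have inj: "\<sigma> i = \<sigma> j \<longleftrightarrow> i = j" for i j
    using permutes_inj[OF p] by (auto dest: injD)
  have rng: "1 \<le> \<sigma> i \<and> \<sigma> i \<le> n" if "1 \<le> i" "i \<le> n" for i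
    using permutes_in_image[OF p, of i] that by auto
  define sh where "sh a = (if a < v then a else Suc a)" for a
  have sh_less: "sh a < sh b \<longleftrightarrow> a < b" for a b by (auto simp: sh_def)
  have sh_Suc: "sh b = Suc (sh a) \<longleftrightarrow> b = Suc a \<and> Suc a \<noteq> v" for a b
    by (auto simp: sh_def)
  have old: "append_value n \<sigma> v i = sh (\<sigma> i)" if "i \<le> n" for i
    using that by (simp add: append_value_def sh_def)
  have new: "append_value n \<sigma> v (Suc n) = v" by (simp add: append_value_def)
  consider "s \<notin> {1..n}" | "1 \<le> s" "s < n" | "s = n" by fastforce
  then show "s \<in> ?L \<longleftrightarrow> s \<in> ?R"
  proof cases
    case 1
    then show ?thesis using n by (auto simp: lrmax_successions_def)
  next
    case 2
    then show ?thesis by (auto simp: lrmax_successions_def old sh_less sh_Suc)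
  next
    case 3
    have max: "(\<forall>m \<in> {1..<n}. \<sigma> m < \<sigma> n) \<longleftrightarrow> \<sigma> n = n"
    proof
      assume less: "\<forall>m \<in> {1..<n}. \<sigma> m < \<sigma> n"
      have "n \<in> \<sigma> ` {1..n}" unfolding permutes_image[OF p] using n by simp
      then obtain m where "1 \<le> m" "m \<le> n" "\<sigma> m = n" by auto
      with less rng[of n] n show "\<sigma> n = n"
        by (metis atLeastLessThan_iff le_neq_implies_less linorder_not_less order_refl)
    next
      assume "\<sigma> n = n"
      then show "\<forall>m \<in> {1..<n}. \<sigma> m < \<sigma> n"
        using rng inj by (metis atLeastLessThan_iff le_neq_implies_less less_imp_le nat_neq_iff)
    qed
    have "s \<in> ?L \<longleftrightarrow> v = Suc (sh (\<sigma> n)) \<and> \<sigma> n = n"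
      using 3 n by (auto simp: lrmax_successions_def old new sh_less max[symmetric])
    also have "\<dots> \<longleftrightarrow> v = Suc n \<and> \<sigma> n = n" by (auto simp: sh_def)
    also have "\<dots> \<longleftrightarrow> s \<in> ?R" using 3 by (auto simp: lrmax_successions_def)
    finally show ?thesis .
  qed
qed

lemma card_lrmax_successions_append_max:
  assumes p: "\<sigma> permutes {1..n}" and n: "n \<ge> 1"
  shows "card (lrmax_successions (Suc n) (append_value n \<sigma> (Suc n)))
       = card (lrmax_successions n \<sigma>) + (if \<sigma> n = n then 1 else 0)"
proof -
  have "Suc (\<sigma> s) \<noteq> Suc n" if "s \<in> lrmax_successions n \<sigma>" for s
    using that permutes_in_image[OF p, of "Suc s"] by (auto simp: lrmax_successions_def)
  then have "{s \<in> lrmax_successions n \<sigma>. Suc (\<sigma> s) \<noteq> Suc n} = lrmax_successions n \<sigma>" by auto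
  moreover have "n \<notin> lrmax_successions n \<sigma>" by (simp add: lrmax_successions_def)
  ultimately show ?thesis
    using lrmax_successions_append_value[OF p _ n, of "Suc n"] by simp
qed

section \<open>The two generating polynomials\<close>

definition succ_poly :: "nat \<Rightarrow> int poly" where
  "succ_poly n = (\<Sum>\<pi> | \<pi> permutes {1..n}. monom 1 (card (lrmax_successions n \<pi>)))"

definition succ_poly_max_last :: "nat \<Rightarrow> int poly" where
  "succ_poly_max_last n =
     (\<Sum>\<pi> | \<pi> permutes {1..n}. if \<pi> n = n then monom 1 (card (lrmax_successions n \<pi>)) else 0)"

text \<open>
  Of the values \<open>v \<le> n\<close>, the upper values of the \<open>k\<close> occurrences of \<open>\<sigma>\<close> lower the exponent
  by one, so the sum is \<open>k x\<^bsup>k-1\<^esup> + (n - k) x\<^bsup>k\<^esup>\<close>. Written as below it is linear in \<open>x\<^bsup>k\<^esup>\<close> with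
  an operator independent of \<open>k\<close>, and so can be summed over all \<open>\<sigma>\<close>.
\<close>

lemma sum_append_nonmax:
  assumes p: "\<sigma> permutes {1..n}" and n: "n \<ge> 1"
  shows "(\<Sum>v\<in>{1..n}. monom 1 (card (lrmax_successions (Suc n) (append_value n \<sigma> v))))
       = of_nat n * monom 1 (card (lrmax_successions n \<sigma>))
         + (1 - [:0, 1:]) * pderiv (monom (1::int) (card (lrmax_successions n \<sigma>)))"
proof -
  let ?O = "lrmax_successions n \<sigma>"
  define k where "k = card ?O"
  define U where "U = (\<lambda>s. Suc (\<sigma> s)) ` ?O"
  have injO: "inj_on (\<lambda>s. Suc (\<sigma> s)) ?O"
    using permutes_inj[OF p] by (auto simp: inj_on_def dest: injD)
  have U: "U \<subseteq> {1..n}"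
  proof
    fix v assume "v \<in> U"
    then obtain s where "s \<in> ?O" "v = Suc (\<sigma> s)" by (auto simp: U_def)
    then show "v \<in> {1..n}"
      using permutes_in_image[OF p, of "Suc s"] by (auto simp: lrmax_successions_def)
  qed
  have cU: "card U = k" by (simp add: U_def k_def card_image[OF injO])
  have kn: "k \<le> n" using card_mono[OF _ U] cU by simp
  \<comment> \<open>For \<open>v \<in> U\<close> there is an occurrence, so \<open>k \<ge> 1\<close> and the subtraction does not truncate.\<close>
  have eq: "card (lrmax_successions (Suc n) (append_value n \<sigma> v)) = (if v \<in> U then k - 1 else k)"
    if v: "v \<in> {1..n}" for v
  proof -
    have L: "lrmax_successions (Suc n) (append_value n \<sigma> v) = {s \<in> ?O. Suc (\<sigma> s) \<noteq> v}"
      using lrmax_successions_append_value[OF p _ n, of v] v by auto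
    show ?thesis
    proof (cases "v \<in> U")
      case True
      then obtain s where s: "s \<in> ?O" "v = Suc (\<sigma> s)" by (auto simp: U_def)
      then have "{s \<in> ?O. Suc (\<sigma> s) \<noteq> v} = ?O - {s}"
        using injO by (auto simp: inj_on_def)
      then show ?thesis using s True L by (simp add: k_def)
    next
      case False
      then have "{s \<in> ?O. Suc (\<sigma> s) \<noteq> v} = ?O" by (auto simp: U_def)
      then show ?thesis using False L by (simp add: k_def)
    qed
  qed
  have "(\<Sum>v\<in>{1..n}. monom (1::int) (card (lrmax_successions (Suc n) (append_value n \<sigma> v))))
      = (\<Sum>v\<in>{1..n}. if v \<in> U then monom 1 (k - 1) else monom 1 k)"
    by (rule sum.cong) (simp_all add: eq)
  also have "\<dots> = (\<Sum>v\<in>U. monom 1 (k - 1)) + (\<Sum>v\<in>{1..n} - U. monom 1 k)"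
    using U by (simp add: sum.If_cases Int_absorb1 Diff_eq)
  also have "\<dots> = of_nat k * monom 1 (k - 1) + of_nat (n - k) * monom 1 k"
    using U cU by (simp add: card_Diff_subset finite_subset[OF U])
  also have "\<dots> = of_nat n * monom 1 k + (1 - [:0, 1:]) * pderiv (monom 1 k)"
  proof (cases k)
    case 0
    then show ?thesis by (simp add: pderiv_monom)
  next
    case (Suc j)
    have x: "monom (1::int) (Suc j) = [:0, 1:] * monom 1 j" by (simp add: monom_Suc)
    have d: "pderiv (monom (1::int) (Suc j)) = of_nat (Suc j) * monom 1 j"
      by (simp add: pderiv_monom of_nat_poly smult_monom)
    show ?thesis
      unfolding Suc d using kn Suc by (simp add: x of_nat_diff algebra_simps)
  qed
  finally show ?thesis by (simp add: k_def)
qed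

lemma pderiv_sum: "pderiv (sum f A) = (\<Sum>a\<in>A. pderiv (f a))"
  for f :: "'a \<Rightarrow> 'b :: {comm_semiring_1, semiring_no_zero_divisors} poly"
  by (induction A rule: infinite_finite_induct) (simp_all add: pderiv_add)

lemma succ_poly_max_last_Suc:
  "succ_poly_max_last (Suc n)
     = (\<Sum>\<sigma> | \<sigma> permutes {1..n}.
          monom 1 (card (lrmax_successions (Suc n) (append_value n \<sigma> (Suc n)))))"
proof -
  have last: "append_value n \<sigma> v (Suc n) = v" for \<sigma> v by (simp add: append_value_def)
  show ?thesis
    unfolding succ_poly_max_last_def sum_permutes_Suc last by (simp add: sum.delta)
qed

lemma succ_poly_Suc:
  assumes "n \<ge> 1"
  shows "succ_poly (Suc n)
       = of_nat n * succ_poly n + (1 - [:0, 1:]) * pderiv (succ_poly n) + succ_poly_max_last (Suc n)"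
proof -
  have "succ_poly (Suc n) =
     (\<Sum>\<sigma> | \<sigma> permutes {1..n}.
        (\<Sum>v\<in>{1..n}. monom 1 (card (lrmax_successions (Suc n) (append_value n \<sigma> v)))))
     + succ_poly_max_last (Suc n)"
    unfolding succ_poly_def sum_permutes_Suc succ_poly_max_last_Suc
    by (simp add: sum.distrib)
  also have "(\<Sum>\<sigma> | \<sigma> permutes {1..n}.
        (\<Sum>v\<in>{1..n}. monom 1 (card (lrmax_successions (Suc n) (append_value n \<sigma> v)))))
     = of_nat n * succ_poly n + (1 - [:0, 1:]) * pderiv (succ_poly n)"
    unfolding succ_poly_def pderiv_sum sum_distrib_left sum.distrib[symmetric]
    by (rule sum.cong[OF refl], rule sum_append_nonmax[OF _ assms]) simp
  finally show ?thesis .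
qed

lemma succ_poly_max_last_rec:
  assumes "n \<ge> 1"
  shows "succ_poly_max_last (Suc n) = succ_poly n + ([:0, 1:] - 1) * succ_poly_max_last n"
  unfolding succ_poly_max_last_Suc
  unfolding succ_poly_def succ_poly_max_last_def sum_distrib_left sum.distrib[symmetric]
  by (rule sum.cong)
     (auto simp: card_lrmax_successions_append_max[OF _ assms] monom_Suc algebra_simps)

lemma succ_poly_rec:
  assumes "n \<ge> 3"
  shows "succ_poly n = ([:0, 1:] + of_nat n - 1) * succ_poly (n - 1)
                     + (1 - [:0, 1:]) * pderiv (succ_poly (n - 1))
                     + (of_nat n - 2) * (1 - [:0, 1:]) * succ_poly (n - 2)
                     + (1 - [:0, 1:])^2 * pderiv (succ_poly (n - 2))"
proof -
  obtain m where n: "n = Suc (Suc m)" and m: "m \<ge> 1"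
    using assms by (metis Suc_le_D Suc_le_mono numeral_3_eq_3 One_nat_def)
  define x where "x = [:0, 1 :: int:]"
  note e1 = succ_poly_Suc[of "Suc m", folded x_def]
    and e2 = succ_poly_max_last_rec[of "Suc m", folded x_def]
    and e3 = succ_poly_Suc[OF m, folded x_def]
  \<comment> \<open>This eliminates the auxiliary polynomial at the price of a second-order recurrence.\<close>
  have E: "succ_poly_max_last (Suc m)
      = succ_poly (Suc m) - of_nat m * succ_poly m - (1 - x) * pderiv (succ_poly m)"
    using e3 by simp
  have idx: "n - 1 = Suc m" "n - 2 = m" using n by auto
  have "succ_poly n = of_nat (Suc m) * succ_poly (Suc m) + (1 - x) * pderiv (succ_poly (Suc m))
      + (succ_poly (Suc m) + (x - 1) *
          (succ_poly (Suc m) - of_nat m * succ_poly m - (1 - x) * pderiv (succ_poly m)))"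
    unfolding n using e1 e2 E by simp
  also have "\<dots> = (x + of_nat n - 1) * succ_poly (Suc m) + (1 - x) * pderiv (succ_poly (Suc m))
      + (of_nat n - 2) * (1 - x) * succ_poly m + (1 - x)^2 * pderiv (succ_poly m)"
    unfolding n by (simp add: algebra_simps power2_eq_square)
  finally show ?thesis unfolding idx x_def .
qed

lemma succ_poly_1: "succ_poly 1 = 1"
  and succ_poly_2: "succ_poly 2 = 1 + [:0, 1:]"
proof -
  have S1: "{\<pi>. \<pi> permutes {1..1::nat}} = {id}" by (auto simp: permutes_sing)
  have L1: "lrmax_successions (Suc 0) id = {}" by (simp add: lrmax_successions_def)
  show W1: "succ_poly 1 = 1" unfolding succ_poly_def S1 by (simp add: L1)
  have "succ_poly_max_last 1 = 1" unfolding succ_poly_max_last_def S1 by (simp add: L1)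
  with W1 show "succ_poly 2 = 1 + [:0, 1:]"
    using succ_poly_Suc[of 1] succ_poly_max_last_rec[of 1] by (simp add: numeral_2_eq_2)
qed

section \<open>Coefficients\<close>

lemma T_eq_coeff: "T n (int k) = coeff (succ_poly n) k"
proof -
  have "coeff (succ_poly n) k
      = (\<Sum>\<pi> | \<pi> permutes {1..n}. if card (lrmax_successions n \<pi>) = k then 1 else 0)"
    by (simp add: succ_poly_def coeff_sum)
  also have "\<dots> = int (card {\<pi>. \<pi> permutes {1..n} \<and> card (lrmax_successions n \<pi>) = k})"
    by (simp add: sum.If_cases finite_permutations Int_def)
  also have "{\<pi>. \<pi> permutes {1..n} \<and> card (lrmax_successions n \<pi>) = k}
      = {\<pi>. \<pi> permutes {1..n} \<and> int (card (mesh12_occs shaded n \<pi>)) = int k}"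
    by (auto simp: card_mesh12_occs_shaded)
  finally show ?thesis by (simp add: T_def)
qed

lemma T_minus_1: "T n (-1) = 0"
  by (simp add: T_def)

text \<open>Truncating at \<open>k < n\<close> loses nothing, as the positions of occurrences lie in \<open>{1..<n}\<close>.\<close>

lemma T_poly_eq:
  assumes "n \<ge> 1"
  shows "T_poly n = succ_poly n"
proof (rule poly_eqI)
  fix j
  have "coeff (succ_poly n) j = 0" if "j \<ge> n"
    unfolding succ_poly_def coeff_sum
  proof (intro sum.neutral ballI)
    fix \<pi>
    show "coeff (monom 1 (card (lrmax_successions n \<pi>))) j = (0::int)"
      using card_lrmax_successions_less[OF assms, of \<pi>] that by simp
  qed
  then show "coeff (T_poly n) j = coeff (succ_poly n) j"
    by (auto simp: T_poly_def coeff_sum T_eq_coeff not_less)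
qed

lemma coeff_one_minus_x_mult:
  "coeff ((1 - [:0, 1:]) * p) k = coeff p k - (if k = 0 then 0 else coeff p (k - 1))"
  for p :: "int poly"
  by (cases k) (simp_all add: algebra_simps)

lemma T_rec:
  assumes n: "n \<ge> 3" and "k \<ge> 0"
  shows "T n k = (k + 1) * T (n - 1) (k + 1) + (int n - k - 1) * T (n - 1) k + T (n - 1) (k - 1)
               + (k + 1) * T (n - 2) (k + 1) + (int n - 2 * k - 2) * T (n - 2) k
               - (int n - k - 1) * T (n - 2) (k - 1)"
proof -
  obtain j where k: "k = int j" using assms(2) nonneg_int_cases by blast
  define V where "V = succ_poly (n - 1)"
  define W where "W = succ_poly (n - 2)"
  have split: "succ_poly n = [:0, 1:] * V + smult (int n - 1) V + (1 - [:0, 1:]) * pderiv V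
      + smult (int n - 2) ((1 - [:0, 1:]) * W)
      + (1 - [:0, 1:]) * ((1 - [:0, 1:]) * pderiv W)"
    unfolding succ_poly_rec[OF n] V_def[symmetric] W_def[symmetric]
    by (simp add: of_nat_poly algebra_simps power2_eq_square smult_diff_left numeral_poly)
  have V: "T (n - 1) (int i) = coeff V i" and W: "T (n - 2) (int i) = coeff W i" for i
    by (simp_all add: T_eq_coeff V_def W_def)
  show ?thesis
  proof (cases j)
    case 0
    have "T n k = coeff V 1 + (int n - 1) * coeff V 0 + coeff W 1 + (int n - 2) * coeff W 0"
      unfolding k T_eq_coeff split 0
      by (simp add: coeff_one_minus_x_mult coeff_pderiv del: mult_pCons_right)
    then show ?thesis
      using V[of 0] V[of 1] W[of 0] W[of 1] k 0 by (simp add: T_minus_1)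
  next
    case (Suc i)
    have idx: "k - 1 = int i" "k = int (Suc i)" "k + 1 = int (Suc (Suc i))"
      using k Suc by simp_all
    show ?thesis
      unfolding idx(1,3) unfolding idx(2) V W T_eq_coeff[of n] split
      by (cases i; simp add: coeff_one_minus_x_mult coeff_pderiv; simp add: algebra_simps)
  qed
qed

theorem theorem4p4:
  shows "(\<forall>(n::nat) (k::int). n \<ge> 3 \<longrightarrow> k \<ge> 0 \<longrightarrow>
            T n k = (k + 1) * T (n - 1) (k + 1) + (int n - k - 1) * T (n - 1) k + T (n - 1) (k - 1)
                  + (k + 1) * T (n - 2) (k + 1) + (int n - 2 * k - 2) * T (n - 2) k
                  - (int n - k - 1) * T (n - 2) (k - 1))
       \<and> T 1 0 = 1 \<and> T 2 0 = 1 \<and> T 2 1 = 1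
       \<and> (let x = [:0, 1:] :: int poly in
            (\<forall>n::nat. n \<ge> 3 \<longrightarrow>
               T_poly n = (x + of_nat n - 1) * T_poly (n - 1)
                        + (1 - x) * pderiv (T_poly (n - 1))
                        + (of_nat n - 2) * (1 - x) * T_poly (n - 2)
                        + (1 - x)^2 * pderiv (T_poly (n - 2)))
          \<and> T_poly 1 = 1 \<and> T_poly 2 = 1 + x)"
proof -
  have init: "T 1 0 = 1" "T 2 0 = 1" "T 2 1 = 1"
    using T_eq_coeff[of 1 0] T_eq_coeff[of 2 0] T_eq_coeff[of 2 1]
    by (simp_all only: succ_poly_1 succ_poly_2) simp_all
  have T_poly_rec: "T_poly n = ([:0, 1:] + of_nat n - 1) * T_poly (n - 1)
                        + (1 - [:0, 1:]) * pderiv (T_poly (n - 1))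
                        + (of_nat n - 2) * (1 - [:0, 1:]) * T_poly (n - 2)
                        + (1 - [:0, 1:])^2 * pderiv (T_poly (n - 2))" if "n \<ge> 3" for n
  proof -
    have "T_poly n = succ_poly n" "T_poly (n - 1) = succ_poly (n - 1)"
      "T_poly (n - 2) = succ_poly (n - 2)"
      using that by (simp_all add: T_poly_eq)
    then show ?thesis using succ_poly_rec[OF that] by (simp only:)
  qed
  have "T_poly 1 = 1" "T_poly 2 = 1 + [:0, 1:]"
    using T_poly_eq[of 1] T_poly_eq[of 2] succ_poly_1 succ_poly_2 by simp_all
  with init T_rec T_poly_rec show ?thesis
    unfolding Let_def by blast
qed

end
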